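(* Let $V:\mathbb{R}\to\mathbb{R}$ be an arbitrary $2\pi$-periodic function of class $C^2(\mathbb{R})$ (with no further assumption). For any $\kappa>0$ there exists $E_\kappa$ such that for every $E>E_\kappa$ the linearized equation $$\ddot w+(2\kappa+V''(p(t;E)))\,w=0$$ is stable, i.e. its associated Floquet matrix $F_E$ over the period $T(E)$ is stable.
   Context: For $E>\max V$, $p(t;E)$ denotes the solution of $\ddot p+V'(p)=0$ with $\frac{\dot p^2}{2}+V(p)=E$, $p(0;E)=0$ and $\dot p>0$. It increases by $2\pi$ over the time $T(E)=\frac{1}{\sqrt2}\int_{-\pi}^{\pi}\frac{dx}{\sqrt{E-V(x)}}$, so $V''(p(t;E))$ is $T(E)$-periodic in $t$. The Floquet matrix $F_E$ is the $2\times2$ matrix (of determinant $1$) advancing $(w,\dot w)$ over one period $T(E)$. It is called stable if $|\operatorname{tr}F_E|<2$. The equation is the nontrivial part of the linearization of $\ddot x+V'(x)=\kappa(y-x)$, $\ddot y+V'(y)=\kappa(x-y)$ about the synchronous solution $x=y=p(t;E)$, where $\kappa$ is the elastic coupling constant. *)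

theory Defs
  imports "HOL-Analysis.Analysis"
begin

definition C2 :: "(real \<Rightarrow> real) \<Rightarrow> bool" where
  "C2 V \<longleftrightarrow> V differentiable_on UNIV \<and> deriv V differentiable_on UNIV \<and>
           continuous_on UNIV (deriv (deriv V))"

(* Solutions are globally defined on the real line. *)

definition is_rotation :: "(real \<Rightarrow> real) \<Rightarrow> real \<Rightarrow> (real \<Rightarrow> real) \<Rightarrow> bool" where
  "is_rotation V E p \<longleftrightarrow>
     p differentiable_on UNIV \<and> deriv p differentiable_on UNIV \<and>
     (\<forall>t. deriv (deriv p) t + deriv V (p t) = 0) \<and>
     (\<forall>t. (deriv p t)\<^sup>2 / 2 + V (p t) = E) \<and>
     p 0 = 0 \<and> (\<forall>t. deriv p t > 0)"

(* A unique such p exists for C2, periodic V as soon as E > max V;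
   otherwise the value is arbitrary. *)

definition rotation :: "(real \<Rightarrow> real) \<Rightarrow> real \<Rightarrow> real \<Rightarrow> real" where
  "rotation V E = (THE p. is_rotation V E p)"

definition rotation_period :: "(real \<Rightarrow> real) \<Rightarrow> real \<Rightarrow> real" where
  "rotation_period V E = 1 / sqrt 2 * integral {-pi..pi} (\<lambda>x. 1 / sqrt (E - V x))"

definition hill_solution :: "(real \<Rightarrow> real) \<Rightarrow> (real \<Rightarrow> real) \<Rightarrow> bool" where
  "hill_solution a w \<longleftrightarrow>
     w differentiable_on UNIV \<and> deriv w differentiable_on UNIV \<and>
     (\<forall>t. deriv (deriv w) t + a t * w t = 0)"

(* The matrix advancing (w, w') from time 0 to time T. It is uniquely determined for
   continuous a, since the solutions then realize all initial data; its determinant is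
   then 1 because the Wronskian of two solutions is constant. *)

definition floquet_matrix :: "(real \<Rightarrow> real) \<Rightarrow> real \<Rightarrow> real^2^2" where
  "floquet_matrix a T =
     (THE F. \<forall>w. hill_solution a w \<longrightarrow>
        vector [w T, deriv w T] = F *v vector [w 0, deriv w 0])"

definition stable_matrix :: "real^2^2 \<Rightarrow> bool" where
  "stable_matrix F \<longleftrightarrow> \<bar>trace F\<bar> < 2"

definition linearized_floquet :: "(real \<Rightarrow> real) \<Rightarrow> real \<Rightarrow> real \<Rightarrow> real^2^2" where
  "linearized_floquet V \<kappa> E =
     floquet_matrix (\<lambda>t. 2 * \<kappa> + deriv (deriv V) (rotation V E t)) (rotation_period V E)"

end

theory Submission
  imports Defs
begin

text \<open>
  At high energy the rotation is fast: its period \<open>T\<close> is of order \<open>1 / sqrt E\<close>, so over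
  one period the Hill equation \<open>w'' + a w = 0\<close> hardly moves \<open>(w, w')\<close>, and
  the Floquet matrix is close to the identity. As \<open>2\<close> is the boundary value of the stability
  condition, the trace has to be known to the order at which it departs from \<open>2\<close>. That order
  is \<open>T\<^sup>2\<close>: with a bound \<open>M\<close> on \<open>\<bar>a\<bar>\<close>,
    \<open>trace F = 2 - T * (\<integral>\<^sub>0\<^sup>T a) + O(M\<^sup>2 T\<^sup>4)\<close>   if \<open>M * T\<^sup>2 \<le> 1 / 2\<close>
  (lemma \<open>floquet_trace_estimate\<close>). Only the mean of \<open>a\<close> matters.

  Here \<open>a = 2 * \<kappa> + V''(p)\<close>. The constant part gives \<open>- 2 * \<kappa> * T\<^sup>2\<close>, of the right sign
  since \<open>\<kappa> > 0\<close>. The second part is bounded but not small, yet its mean is: at high energy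
  \<open>p\<close> runs at nearly constant speed through one period of \<open>V\<close>, over which \<open>V''\<close> has mean
  zero. Precisely, along the motion
    \<open>(V'(p) / p')' = V''(p) + (V'(p))\<^sup>2 / p'\<^sup>2\<close>,
  the left-hand side integrates to zero over a period, and \<open>p'\<^sup>2 = 2 * (E - V(p))\<close> is large
  (lemma \<open>curvature_average_along_rotation\<close>). So \<open>trace F = 2 - 2 * \<kappa> * T\<^sup>2 + O(T\<^sup>2 / E)\<close>,
  which lies strictly between \<open>-2\<close> and \<open>2\<close> once \<open>E\<close> is large.

  The definite descriptions in the definitions of the rotation and of the Floquet matrix
  demand existence and uniqueness for the two differential equations. For the autonomous
  first-order equation \<open>p' = sqrt (2 * (E - V(p)))\<close> the solution is the inverse of the
  travel time \<open>\<tau>(x) = \<integral>\<^sub>0\<^sup>x dy / sqrt (2 * (E - V y))\<close> (lemma \<open>rotation_over_period\<close>). For the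
  Hill equation, solutions are Picard series (lemma \<open>hill_initial_value_problem\<close>), and constancy of
  Wronskians then expresses every solution through two fundamental ones
  (lemma \<open>floquet_matrix_eq\<close>).
\<close>

section \<open>Bounds from derivatives\<close>

lemma antiderivative_exists:
  fixes f :: "real \<Rightarrow> real"
  assumes "continuous_on UNIV f"
  shows "\<exists>F. F 0 = 0 \<and> (\<forall>t. (F has_real_derivative f t) (at t))"
proof -
  have "\<exists>F. \<forall>x::real. -\<infinity> < ereal x \<longrightarrow> ereal x < \<infinity> \<longrightarrow> (F has_vector_derivative f x) (at x)"
    using assms by (intro einterval_antiderivative) (auto simp: continuous_on_eq_continuous_at)
  then obtain F where F: "\<And>t. (F has_real_derivative f t) (at t)"
    by (auto simp: has_real_derivative_iff_has_vector_derivative)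
  show ?thesis
    by (rule exI[of _ "\<lambda>t. F t - F 0"]) (auto intro!: derivative_eq_intros F)
qed

lemma increment_bound:
  fixes f :: "real \<Rightarrow> real"
  assumes "\<And>s. (f has_real_derivative f' s) (at s)"
    and "\<And>s. 0 \<le> s \<Longrightarrow> s \<le> t \<Longrightarrow> \<bar>f' s\<bar> \<le> c"
    and "0 \<le> t"
  shows "\<bar>f t - f 0\<bar> \<le> c * t"
  using field_differentiable_bound[of "{0..t}" f f' c t 0] assms
  by (auto intro: has_field_derivative_at_within)

text \<open>
  Both \<open>g - f\<close> and \<open>g + f\<close> are nondecreasing and vanish at \<open>0\<close>. The absolute value around \<open>g t\<close>
  makes the comparison valid on both sides of \<open>0\<close>, which lets solutions be built on the whole line at once.
\<close>

lemma abs_le_of_deriv_le: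
  fixes f g :: "real \<Rightarrow> real"
  assumes f: "\<And>s. (f has_real_derivative f' s) (at s)"
    and g: "\<And>s. (g has_real_derivative g' s) (at s)"
    and le: "\<And>s. \<bar>f' s\<bar> \<le> g' s"
    and "f 0 = 0" "g 0 = 0"
  shows "\<bar>f t\<bar> \<le> \<bar>g t\<bar>"
proof -
  have "g x - f x \<le> g y - f y" if "x \<le> y" for x y
  proof (rule DERIV_nonneg_imp_nondecreasing[OF that])
    fix s
    have "((\<lambda>s. g s - f s) has_real_derivative g' s - f' s) (at s)"
      by (intro derivative_intros f g)
    then show "\<exists>d. ((\<lambda>s. g s - f s) has_real_derivative d) (at s) \<and> 0 \<le> d"
      using le[of s] by (intro exI[of _ "g' s - f' s"]) auto
  qed
  moreover have "g x + f x \<le> g y + f y" if "x \<le> y" for x y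
  proof (rule DERIV_nonneg_imp_nondecreasing[OF that])
    fix s
    have "((\<lambda>s. g s + f s) has_real_derivative g' s + f' s) (at s)"
      by (intro derivative_intros f g)
    then show "\<exists>d. ((\<lambda>s. g s + f s) has_real_derivative d) (at s) \<and> 0 \<le> d"
      using le[of s] by (intro exI[of _ "g' s + f' s"]) auto
  qed
  ultimately show ?thesis
    using assms(4,5) by (cases "0 \<le> t") (smt (verit))+
qed

text \<open>
  Since \<open>g\<close> is bounded on compact intervals, the Weierstrass test gives uniform convergence of
  the differentiated series there; \<open>g\<close> itself may grow, as it does for Picard iterates.
\<close>

lemma termwise_derivative:
  fixes f f' :: "nat \<Rightarrow> real \<Rightarrow> real"
  assumes deriv: "\<And>n t. (f n has_real_derivative f' n t) (at t)"
    and bound: "\<And>n t. \<bar>f' n t\<bar> \<le> B n * g t"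
    and "summable B" "\<And>n. 0 \<le> B n"
    and g: "continuous_on UNIV g"
    and "summable (\<lambda>n. f n 0)"
  shows "((\<lambda>t. \<Sum>n. f n t) has_real_derivative (\<Sum>n. f' n t)) (at t)"
proof -
  define R where "R = \<bar>t\<bar> + 1"
  have "bounded (g ` {-R..R})"
    by (intro compact_imp_bounded compact_continuous_image continuous_on_subset[OF g]) auto
  then obtain c where c: "\<And>s. s \<in> {-R..R} \<Longrightarrow> \<bar>g s\<bar> \<le> c"
    unfolding bounded_iff by fastforce
  have "uniformly_convergent_on {-R..R} (\<lambda>n s. \<Sum>i<n. f' i s)"
  proof (rule Weierstrass_m_test'[where M = "\<lambda>n. B n * c"])
    fix n s assume s: "s \<in> {-R..R}"
    have "\<bar>f' n s\<bar> \<le> B n * g s" by (rule bound)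
    also have "\<dots> \<le> B n * c" using c[OF s] assms(4) by (intro mult_left_mono) auto
    finally show "norm (f' n s) \<le> B n * c" by simp
  qed (use assms(3) in \<open>auto intro: summable_mult2\<close>)
  then show ?thesis
    by (rule has_field_derivative_series'(2)[where S = "{-R..R}" and ?x0.0 = 0, rotated 2])
      (auto simp: R_def intro: has_field_derivative_at_within deriv assms)
qed

section \<open>Solutions of the Hill equation\<close>

lemma hill_solutionI:
  assumes "\<And>t. (w has_real_derivative v t) (at t)"
    and "\<And>t. (v has_real_derivative - (a t * w t)) (at t)"
  shows "hill_solution a w" "deriv w = v"
proof -
  show w: "deriv w = v" using assms(1) by (auto intro: DERIV_imp_deriv)
  have "deriv v t = - (a t * w t)" for t using assms(2) by (auto intro: DERIV_imp_deriv)
  then show "hill_solution a w"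
    using assms unfolding hill_solution_def w
    by (auto simp: differentiable_on_def real_differentiable_def)
qed

lemma hill_solutionD:
  assumes "hill_solution a w"
  shows "(w has_real_derivative deriv w t) (at t)"
    and "(deriv w has_real_derivative - (a t * w t)) (at t)"
proof -
  have "deriv (deriv w) t = - (a t * w t)"
    using assms by (simp add: hill_solution_def eq_neg_iff_add_eq_0)
  then show "(w has_real_derivative deriv w t) (at t)"
    "(deriv w has_real_derivative - (a t * w t)) (at t)"
    using assms by (metis UNIV_I hill_solution_def differentiable_on_def DERIV_deriv_iff_real_differentiable)+
qed

text \<open>
  The solution is the sum of the Picard iterates \<open>u 0 t = \<alpha> + \<beta> * t\<close>, \<open>u (Suc n)'' = - a * u n\<close>
  with zero initial data. Measured against the weight \<open>cosh (\<mu> * t)\<close>, integration from \<open>0\<close> in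
  either direction gains a factor \<open>1 / \<mu>\<close>; for \<open>\<mu>\<close> large compared with the bound \<open>M\<close>
  the bound on each iterate is half the bound on the previous one, uniformly on the line.
\<close>

lemma hill_initial_value_problem:
  fixes a :: "real \<Rightarrow> real"
  assumes a: "continuous_on UNIV a" and M: "\<And>t. \<bar>a t\<bar> \<le> M"
  shows "\<exists>w. hill_solution a w \<and> w 0 = \<alpha> \<and> deriv w 0 = \<beta>"
proof -
  obtain J :: "(real \<Rightarrow> real) \<Rightarrow> real \<Rightarrow> real"
    where J0: "\<And>f. continuous_on UNIV f \<Longrightarrow> J f 0 = 0"
      and J: "\<And>f t. continuous_on UNIV f \<Longrightarrow> (J f has_real_derivative f t) (at t)"
    using antiderivative_exists by metis
  have Jcont: "continuous_on UNIV (J f)" if "continuous_on UNIV f" for f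
    using J[OF that] by (intro DERIV_continuous_on) (auto intro: has_field_derivative_at_within)
  have "0 \<le> M" using M[of 0] by linarith
  define \<mu> where "\<mu> = 2 * (M + 1)"
  have \<mu>: "\<mu> \<ge> 2" "M / \<mu> \<le> 1 / 2" using \<open>0 \<le> M\<close> by (auto simp: \<mu>_def field_simps)
  have Jbound: "\<bar>J f t\<bar> \<le> c / \<mu> * cosh (\<mu> * t)"
    if f: "continuous_on UNIV f" and c: "\<And>t. \<bar>f t\<bar> \<le> c * cosh (\<mu> * t)" for f c t
  proof -
    have "0 \<le> c" using c[of 0] by simp
    have "\<bar>J f t\<bar> \<le> \<bar>c / \<mu> * sinh (\<mu> * t)\<bar>"
    proof (rule abs_le_of_deriv_le[where f' = f and g = "\<lambda>t. c / \<mu> * sinh (\<mu> * t)"])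
      show "((\<lambda>t. c / \<mu> * sinh (\<mu> * t)) has_real_derivative c * cosh (\<mu> * s)) (at s)" for s
        using \<mu> by (auto intro!: derivative_eq_intros)
    qed (use f c J J0 in auto)
    also have "\<dots> = c / \<mu> * \<bar>sinh (\<mu> * t)\<bar>" using \<open>0 \<le> c\<close> \<mu> by (simp add: abs_mult)
    also have "\<dots> \<le> c / \<mu> * cosh (\<mu> * t)"
      using \<open>0 \<le> c\<close> \<mu> sinh_le_cosh_real[of "\<mu> * t"] sinh_le_cosh_real[of "- (\<mu> * t)"]
      by (intro mult_left_mono) auto
    finally show ?thesis .
  qed
  define C where "C = \<bar>\<alpha>\<bar> + \<bar>\<beta>\<bar>"
  define z where "z u t = - (a t * u t)" for u and t :: real
  define u where "u n = ((\<lambda>u. J (J (z u))) ^^ n) (\<lambda>t. \<alpha> + \<beta> * t)" for n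
  have u_Suc: "u (Suc n) = J (J (z (u n)))" for n by (simp add: u_def)
  have z_cont: "continuous_on UNIV (z f)" if "continuous_on UNIV f" for f
    unfolding z_def by (intro continuous_intros a that)
  have z_bound: "\<bar>z f t\<bar> \<le> M * c * cosh (\<mu> * t)" if "\<And>t. \<bar>f t\<bar> \<le> c * cosh (\<mu> * t)" for f t c
    using mult_mono[OF M[of t] that[of t]] \<open>0 \<le> M\<close> by (simp add: z_def abs_mult mult_ac)
  have u: "continuous_on UNIV (u n) \<and> (\<forall>t. \<bar>u n t\<bar> \<le> C * (1/2)^n * cosh (\<mu> * t))" for n
  proof (induction n)
    case 0
    have "\<bar>\<alpha> + \<beta> * t\<bar> \<le> C * cosh (\<mu> * t)" for t
    proof -
      have "\<bar>t\<bar> \<le> \<bar>sinh (\<mu> * t) / \<mu>\<bar>"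
        by (rule abs_le_of_deriv_le[where f' = "\<lambda>_. 1" and g = "\<lambda>t. sinh (\<mu> * t) / \<mu>" and g' = "\<lambda>s. cosh (\<mu> * s)"])
          (use \<mu> cosh_real_ge_1 in \<open>auto intro!: derivative_eq_intros\<close>)
      also have "\<dots> \<le> \<bar>sinh (\<mu> * t)\<bar>"
        using \<mu> by (simp add: divide_le_eq mult_le_cancel_left1)
      also have "\<dots> \<le> cosh (\<mu> * t)"
        using sinh_le_cosh_real[of "\<mu> * t"] sinh_le_cosh_real[of "- (\<mu> * t)"] by auto
      finally have "\<bar>\<beta>\<bar> * \<bar>t\<bar> \<le> \<bar>\<beta>\<bar> * cosh (\<mu> * t)" by (intro mult_left_mono) auto
      moreover have "\<bar>\<alpha>\<bar> * 1 \<le> \<bar>\<alpha>\<bar> * cosh (\<mu> * t)" by (intro mult_left_mono cosh_real_ge_1) auto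
      moreover have "\<bar>\<alpha> + \<beta> * t\<bar> \<le> \<bar>\<alpha>\<bar> * 1 + \<bar>\<beta>\<bar> * \<bar>t\<bar>"
        by (metis abs_mult abs_triangle_ineq mult_1_right)
      ultimately show ?thesis by (simp add: C_def distrib_right)
    qed
    then show ?case by (auto simp: u_def intro!: continuous_intros)
  next
    case (Suc n)
    let ?c = "M * (C * (1/2)^n)"
    have z: "\<bar>z (u n) t\<bar> \<le> ?c * cosh (\<mu> * t)" for t by (intro z_bound) (use Suc in auto)
    have zc: "continuous_on UNIV (z (u n))" using Suc by (intro z_cont) auto
    have "\<bar>J (J (z (u n))) t\<bar> \<le> ?c / \<mu> / \<mu> * cosh (\<mu> * t)" for t
      by (intro Jbound Jcont zc z)
    moreover have "?c / \<mu> / \<mu> \<le> C * (1/2) ^ Suc n"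
    proof -
      have "M / \<mu> / \<mu> \<le> (1 / 2) / 1" by (rule frac_le) (use \<mu> in auto)
      then have "(M / \<mu> / \<mu>) * (C * (1/2)^n) \<le> 1 / 2 * (C * (1/2)^n)"
        by (intro mult_right_mono) (auto simp: C_def)
      then show ?thesis by (simp add: mult_ac)
    qed
    ultimately have "\<bar>u (Suc n) t\<bar> \<le> C * (1/2) ^ Suc n * cosh (\<mu> * t)" for t
      unfolding u_Suc by (meson mult_right_mono cosh_real_nonneg order_trans)
    then show ?case unfolding u_Suc by (auto intro!: Jcont zc)
  qed
  \<comment> \<open>The first and second derivatives of the iterates. The term with index \<open>0\<close> is
      affine and has no predecessor, hence the case distinctions.\<close>
  define v where "v n = (case n of 0 \<Rightarrow> (\<lambda>_. \<beta>) | Suc m \<Rightarrow> J (z (u m)))" for n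
  define v' where "v' n = (case n of 0 \<Rightarrow> (\<lambda>_. 0) | Suc m \<Rightarrow> z (u m))" for n
  have zc: "continuous_on UNIV (z (u n))" for n using u by (intro z_cont) auto
  have zb: "\<bar>z (u n) t\<bar> \<le> M * (C * (1/2)^n) * cosh (\<mu> * t)" for n t
    by (intro z_bound) (use u in auto)
  have "0 \<le> C" by (simp add: C_def)
  have u': "(u n has_real_derivative v n t) (at t)" for n t
  proof (cases n)
    case 0
    then show ?thesis by (auto simp: u_def v_def intro!: derivative_eq_intros)
  next
    case (Suc m)
    then show ?thesis by (auto simp: u_Suc v_def intro!: J Jcont zc)
  qed
  have v: "(v n has_real_derivative v' n t) (at t)" for n t
    by (cases n) (auto simp: v_def v'_def intro!: J zc)
  have v_bound: "\<bar>v n t\<bar> \<le> C * (1/2)^n * cosh (\<mu> * t)" for n t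
  proof (cases n)
    case 0
    have "\<bar>\<beta>\<bar> * 1 \<le> C * cosh (\<mu> * t)"
      by (intro mult_mono cosh_real_ge_1) (auto simp: C_def)
    then show ?thesis by (simp add: v_def 0)
  next
    case (Suc m)
    have "\<bar>J (z (u m)) t\<bar> \<le> M * (C * (1/2)^m) / \<mu> * cosh (\<mu> * t)"
      by (intro Jbound zc zb)
    also have "\<dots> = M / \<mu> * (C * (1/2)^m * cosh (\<mu> * t))" by simp
    also have "\<dots> \<le> 1 / 2 * (C * (1/2)^m * cosh (\<mu> * t))"
      by (intro mult_right_mono \<mu>) (use \<open>0 \<le> C\<close> in auto)
    finally show ?thesis by (simp add: v_def Suc)
  qed
  have v'_bound: "\<bar>v' n t\<bar> \<le> 2 * M * C * (1/2)^n * cosh (\<mu> * t)" for n t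
    using zb[of "n - 1" t] \<open>0 \<le> M\<close> \<open>0 \<le> C\<close> by (cases n) (auto simp: v'_def mult_ac)
  have geo: "summable (\<lambda>n. c * (1/2)^n)" for c :: real
    by (intro summable_mult summable_geometric) auto
  have u_sum: "summable (\<lambda>n. u n t)" for t
    by (rule summable_comparison_test'[OF summable_mult2[OF geo[of C], of "cosh (\<mu> * t)"]])
      (use u in auto)
  have v'_sum: "summable (\<lambda>n. v' n t)" for t
    by (rule summable_comparison_test'[OF summable_mult2[OF geo[of "2 * M * C"], of "cosh (\<mu> * t)"]])
      (use v'_bound in auto)
  have v0: "v n 0 = (if n = 0 then \<beta> else 0)" for n
    by (cases n) (auto simp: v_def J0 zc)
  have u0: "u n 0 = (if n = 0 then \<alpha> else 0)" for n
    by (cases n) (simp add: u_def, auto simp: u_Suc J0 zc Jcont)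
  define w where "w t = (\<Sum>n. u n t)" for t
  define w' where "w' t = (\<Sum>n. v n t)" for t
  have w: "(w has_real_derivative w' t) (at t)" for t
    unfolding w_def w'_def
    by (rule termwise_derivative[OF u' v_bound]) (use geo \<open>0 \<le> C\<close> u_sum in \<open>auto intro!: continuous_intros\<close>)
  have "(w' has_real_derivative (\<Sum>n. v' n t)) (at t)" for t
    unfolding w'_def
    by (rule termwise_derivative[OF v v'_bound])
      (use geo \<open>0 \<le> C\<close> \<open>0 \<le> M\<close> in \<open>auto simp: v0 intro!: continuous_intros\<close>)
  moreover have "(\<Sum>n. v' n t) = - (a t * w t)" for t
    using suminf_split_head[OF v'_sum[of t]] suminf_mult[OF u_sum[of t], of "- a t"]
    by (simp add: v'_def z_def w_def)
  ultimately have w': "(w' has_real_derivative - (a t * w t)) (at t)" for t by simp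
  have "w 0 = \<alpha>" "w' 0 = \<beta>"
    unfolding w_def w'_def u0 v0
    using sums_unique[OF sums_single[of 0 "\<lambda>_. \<alpha>"]]
      sums_unique[OF sums_single[of 0 "\<lambda>_. \<beta>"]] by simp_all
  with hill_solutionI[of w w' a, OF w w'] show ?thesis by auto
qed

section \<open>The Floquet matrix and its trace\<close>

lemma wronskian_constant:
  assumes u: "hill_solution a u" and w: "hill_solution a w"
  shows "u t * deriv w t - deriv u t * w t = u 0 * deriv w 0 - deriv u 0 * w 0"
proof (rule DERIV_isconst_all[where f = "\<lambda>t. u t * deriv w t - deriv u t * w t"], rule allI)
  fix s
  show "((\<lambda>t. u t * deriv w t - deriv u t * w t) has_real_derivative 0) (at s)"
    by (auto intro!: derivative_eq_intros hill_solutionD u w simp: algebra_simps)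
qed

text \<open>
  The three Wronskians of \<open>w\<close>, \<open>\<phi>\<close> and \<open>\<psi>\<close> are known from the data at \<open>0\<close> and determine
  \<open>(w T, deriv w T)\<close> linearly; this also gives uniqueness of solutions without a Gronwall estimate.
\<close>

lemma floquet_matrix_eq:
  assumes \<phi>: "hill_solution a \<phi>" "\<phi> 0 = 1" "deriv \<phi> 0 = 0"
    and \<psi>: "hill_solution a \<psi>" "\<psi> 0 = 0" "deriv \<psi> 0 = 1"
  shows "floquet_matrix a T = vector [vector [\<phi> T, \<psi> T], vector [deriv \<phi> T, deriv \<psi> T]]"
  unfolding floquet_matrix_def
proof (rule the_equality)
  show "\<forall>w. hill_solution a w \<longrightarrow> vector [w T, deriv w T] =
      (vector [vector [\<phi> T, \<psi> T], vector [deriv \<phi> T, deriv \<psi> T]] :: real^2^2) *v vector [w 0, deriv w 0]"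
  proof (intro allI impI)
    fix w assume w: "hill_solution a w"
    have "\<phi> T * deriv \<psi> T - deriv \<phi> T * \<psi> T = 1"
      "w T * deriv \<phi> T - deriv w T * \<phi> T = - deriv w 0"
      "w T * deriv \<psi> T - deriv w T * \<psi> T = w 0"
      using wronskian_constant[OF \<phi>(1) \<psi>(1), of T] wronskian_constant[OF w \<phi>(1), of T]
        wronskian_constant[OF w \<psi>(1), of T] \<phi> \<psi> by auto
    then have "w T = \<phi> T * w 0 + \<psi> T * deriv w 0"
      "deriv w T = deriv \<phi> T * w 0 + deriv \<psi> T * deriv w 0"
      by algebra+
    then show "vector [w T, deriv w T] =
      (vector [vector [\<phi> T, \<psi> T], vector [deriv \<phi> T, deriv \<psi> T]] :: real^2^2) *v vector [w 0, deriv w 0]"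
      by (simp add: vec_eq_iff forall_2 matrix_vector_mult_def sum_2)
  qed
next
  fix F :: "real^2^2"
  assume "\<forall>w. hill_solution a w \<longrightarrow> vector [w T, deriv w T] = F *v vector [w 0, deriv w 0]"
  then have "vector [\<phi> T, deriv \<phi> T] = F *v vector [1, 0]"
    "vector [\<psi> T, deriv \<psi> T] = F *v vector [0, 1]"
    using \<phi> \<psi> by metis+
  then show "F = vector [vector [\<phi> T, \<psi> T], vector [deriv \<phi> T, deriv \<psi> T]]"
    by (simp add: vec_eq_iff forall_2 matrix_vector_mult_def sum_2)
qed

text \<open>
  If \<open>m\<close> is the maximum of \<open>\<bar>w\<bar>\<close> on \<open>{0..T}\<close>, then \<open>\<bar>w''\<bar> \<le> M * m\<close>, so \<open>w\<close> deviates from its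
  tangent at \<open>0\<close> by at most \<open>M * m * T\<^sup>2 \<le> m / 2\<close>. This bounds \<open>m\<close> itself by
  twice the size of the tangent, and inserting that bound gives the claim.
\<close>

lemma hill_solution_near_linear:
  assumes w: "hill_solution a w" and M: "\<And>t. \<bar>a t\<bar> \<le> M"
    and T: "M * T\<^sup>2 \<le> 1 / 2" and t: "0 \<le> t" "t \<le> T"
  shows "\<bar>w t - (w 0 + deriv w 0 * t)\<bar> \<le> 2 * M * T\<^sup>2 * (\<bar>w 0\<bar> + \<bar>deriv w 0\<bar> * T)"
proof -
  note dw = hill_solutionD[OF w]
  have "0 \<le> M" using M[of 0] by linarith
  have "continuous_on {0..T} (\<lambda>t. \<bar>w t\<bar>)"
    using dw by (intro continuous_intros DERIV_continuous_on) (auto intro: has_field_derivative_at_within)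
  then obtain s where s: "0 \<le> s" "s \<le> T" and max: "\<And>r. 0 \<le> r \<Longrightarrow> r \<le> T \<Longrightarrow> \<bar>w r\<bar> \<le> \<bar>w s\<bar>"
    using continuous_attains_sup[of "{0..T}" "\<lambda>t. \<bar>w t\<bar>"] t by auto
  define m where "m = \<bar>w s\<bar>"
  have dev: "\<bar>w r - (w 0 + deriv w 0 * r)\<bar> \<le> M * m * T\<^sup>2" if r: "0 \<le> r" "r \<le> T" for r
  proof -
    have slope: "\<bar>deriv w q - deriv w 0\<bar> \<le> M * m * T" if q: "0 \<le> q" "q \<le> r" for q
    proof -
      have "\<bar>deriv w q - deriv w 0\<bar> \<le> M * m * q"
      proof (rule increment_bound[OF dw(2)])
        fix x assume x: "0 \<le> x" "x \<le> q"
        then have "\<bar>w x\<bar> \<le> m" using max q r by (simp add: m_def)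
        then show "\<bar>- (a x * w x)\<bar> \<le> M * m"
          using mult_mono[OF M[of x], of "\<bar>w x\<bar>" m] \<open>0 \<le> M\<close> by (simp add: abs_mult)
      qed (use q in auto)
      also have "\<dots> \<le> M * m * T" using q r \<open>0 \<le> M\<close> by (intro mult_left_mono) (auto simp: m_def)
      finally show ?thesis .
    qed
    have "\<bar>(w r - deriv w 0 * r) - (w 0 - deriv w 0 * 0)\<bar> \<le> M * m * T * r"
      by (rule increment_bound[where f' = "\<lambda>x. deriv w x - deriv w 0"])
        (use slope r in \<open>auto intro!: derivative_eq_intros dw\<close>)
    also have "\<dots> \<le> M * m * T * T"
      using r \<open>0 \<le> M\<close> t by (intro mult_left_mono) (auto simp: m_def)
    finally show ?thesis by (simp add: power2_eq_square algebra_simps)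
  qed
  have "M * m * T\<^sup>2 \<le> m / 2"
    using mult_right_mono[OF T, of m] by (simp add: m_def mult_ac)
  moreover have "\<bar>deriv w 0 * s\<bar> \<le> \<bar>deriv w 0\<bar> * T"
    using s by (simp add: abs_mult mult_left_mono)
  ultimately have "m \<le> 2 * (\<bar>w 0\<bar> + \<bar>deriv w 0\<bar> * T)"
    using dev[OF s] unfolding m_def by argo
  then have "M * T\<^sup>2 * m \<le> M * T\<^sup>2 * (2 * (\<bar>w 0\<bar> + \<bar>deriv w 0\<bar> * T))"
    using \<open>0 \<le> M\<close> by (intro mult_left_mono) auto
  then show ?thesis using dev[OF t] by (simp add: algebra_simps)
qed

text \<open>
  The fundamental solutions are \<open>\<phi> = 1 + O(T\<^sup>2)\<close> and \<open>\<psi> = t + O(T\<^sup>3)\<close>. The trace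
  \<open>\<phi> T + deriv \<psi> T\<close> is the end value of a quantity \<open>H\<close> whose derivative only contains the
  deviations \<open>1 - \<phi>\<close> and \<open>t - \<psi>\<close>. The error is of fourth order in \<open>T\<close>, two orders beyond the
  term \<open>T * (A T - A 0)\<close> that decides stability.
\<close>

lemma floquet_trace_estimate:
  assumes a: "continuous_on UNIV a" and M: "\<And>t. \<bar>a t\<bar> \<le> M"
    and A: "\<And>t. (A has_real_derivative a t) (at t)"
    and T: "0 \<le> T" "M * T\<^sup>2 \<le> 1 / 2"
  shows "\<bar>trace (floquet_matrix a T) - (2 - T * (A T - A 0))\<bar> \<le> 4 * M\<^sup>2 * T ^ 4"
proof -
  obtain \<phi> where \<phi>: "hill_solution a \<phi>" "\<phi> 0 = 1" "deriv \<phi> 0 = 0"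
    using hill_initial_value_problem[OF a M] by metis
  obtain \<psi> where \<psi>: "hill_solution a \<psi>" "\<psi> 0 = 0" "deriv \<psi> 0 = 1"
    using hill_initial_value_problem[OF a M] by metis
  have "0 \<le> M" using M[of 0] by linarith
  have tr: "trace (floquet_matrix a T) = \<phi> T + deriv \<psi> T"
    by (simp add: floquet_matrix_eq[OF \<phi> \<psi>] trace_def sum_2)
  \<comment> \<open>The weight \<open>T - t\<close> integrates \<open>deriv (deriv \<phi>)\<close> twice from \<open>0\<close> to \<open>T\<close>; adding \<open>T * A t\<close>
      removes the leading part \<open>- T * a t\<close> of the derivative.\<close>
  define H where "H t = \<phi> t + (T - t) * deriv \<phi> t + deriv \<psi> t + T * A t" for t
  have "\<bar>H T - H 0\<bar> \<le> 4 * M\<^sup>2 * T ^ 3 * T"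
  proof (rule increment_bound)
    fix t
    show "(H has_real_derivative a t * ((T - t) * (1 - \<phi> t) + (t - \<psi> t))) (at t)"
      unfolding H_def by (auto intro!: derivative_eq_intros hill_solutionD \<phi> \<psi> A simp: algebra_simps)
  next
    fix t assume t: "0 \<le> t" "t \<le> T"
    have "\<bar>\<phi> t - 1\<bar> \<le> 2 * M * T\<^sup>2"
      using hill_solution_near_linear[OF \<phi>(1) M T(2) t] \<phi> by simp
    then have "\<bar>T - t\<bar> * \<bar>1 - \<phi> t\<bar> \<le> T * (2 * M * T\<^sup>2)"
      using t by (intro mult_mono) auto
    moreover have "\<bar>t - \<psi> t\<bar> \<le> 2 * M * T\<^sup>2 * T"
      using hill_solution_near_linear[OF \<psi>(1) M T(2) t] \<psi> by simp
    moreover have "T * (2 * M * T\<^sup>2) + 2 * M * T\<^sup>2 * T = 4 * M * T ^ 3"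
      by (simp add: power2_eq_square power3_eq_cube)
    ultimately have "\<bar>(T - t) * (1 - \<phi> t) + (t - \<psi> t)\<bar> \<le> 4 * M * T ^ 3"
      using abs_triangle_ineq[of "(T - t) * (1 - \<phi> t)" "t - \<psi> t"]
      unfolding abs_mult by linarith
    then have "\<bar>a t\<bar> * \<bar>(T - t) * (1 - \<phi> t) + (t - \<psi> t)\<bar> \<le> M * (4 * M * T ^ 3)"
      using M \<open>0 \<le> M\<close> by (intro mult_mono) auto
    then show "\<bar>a t * ((T - t) * (1 - \<phi> t) + (t - \<psi> t))\<bar> \<le> 4 * M\<^sup>2 * T ^ 3"
      by (simp add: abs_mult power2_eq_square mult_ac)
  qed (rule T)
  moreover have "H T - H 0 = trace (floquet_matrix a T) - (2 - T * (A T - A 0))"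
    by (simp add: H_def tr \<phi> \<psi> algebra_simps)
  moreover have "4 * M\<^sup>2 * T ^ 3 * T = 4 * M\<^sup>2 * T ^ 4"
    by (simp add: power_numeral_reduce)
  ultimately show ?thesis by simp
qed

section \<open>Periodic functions and global inverses\<close>

lemma deriv_periodic:
  fixes f :: "real \<Rightarrow> real"
  assumes "\<And>x. f (x + c) = f x"
  shows "deriv f (x + c) = deriv f x"
  by (simp add: deriv_def DERIV_shift assms)

lemma continuous_periodic_bounded:
  fixes f :: "real \<Rightarrow> real"
  assumes cont: "continuous_on UNIV f" and per: "\<And>x. f (x + 2 * pi) = f x"
  obtains B where "\<And>x. \<bar>f x\<bar> \<le> B"
proof -
  interpret periodic_fun_simple f "2 * pi" by standard (rule per)
  have "bounded (f ` {0..2*pi})"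
    by (intro compact_imp_bounded compact_continuous_image continuous_on_subset[OF cont]) auto
  then obtain B where B: "\<And>x. x \<in> {0..2*pi} \<Longrightarrow> \<bar>f x\<bar> \<le> B"
    unfolding bounded_iff by fastforce
  have "\<bar>f x\<bar> \<le> B" for x
  proof -
    define n where "n = \<lfloor>x / (2 * pi)\<rfloor>"
    have "of_int n \<le> x / (2 * pi)" "x / (2 * pi) \<le> of_int n + 1"
      unfolding n_def by linarith+
    then have "x - of_int n * (2 * pi) \<in> {0..2*pi}"
      by (simp add: field_simps)
    then show ?thesis using B minus_of_int[of x n] by metis
  qed
  then show ?thesis by (rule that)
qed

text \<open>
  A uniform positive lower bound on the slope makes \<open>\<tau>\<close> expanding, hence unbounded in both
  directions and with a Lipschitz inverse.
\<close>

lemma global_inverse_function: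
  fixes \<tau> \<tau>' :: "real \<Rightarrow> real"
  assumes \<tau>: "\<And>x. (\<tau> has_real_derivative \<tau>' x) (at x)"
    and c: "0 < c" "\<And>x. c \<le> \<tau>' x"
  obtains p where "\<And>t. \<tau> (p t) = t" "\<And>x. p (\<tau> x) = x"
    "\<And>t. (p has_real_derivative inverse (\<tau>' (p t))) (at t)"
proof -
  have expand: "c * (y - x) \<le> \<tau> y - \<tau> x" if "x \<le> y" for x y
  proof -
    have "\<tau> x - c * x \<le> \<tau> y - c * y"
    proof (rule DERIV_nonneg_imp_nondecreasing[OF that])
      fix z
      have "((\<lambda>x. \<tau> x - c * x) has_real_derivative \<tau>' z - c) (at z)"
        by (auto intro!: derivative_eq_intros \<tau>)
      then show "\<exists>d. ((\<lambda>x. \<tau> x - c * x) has_real_derivative d) (at z) \<and> 0 \<le> d"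
        using c(2)[of z] by (intro exI[of _ "\<tau>' z - c"]) auto
    qed
    then show ?thesis by (simp add: algebra_simps)
  qed
  have expand_abs: "c * \<bar>y - x\<bar> \<le> \<bar>\<tau> y - \<tau> x\<bar>" for x y
    using expand[of x y] expand[of y x] by (cases "x \<le> y") (auto simp: abs_if)
  have cont: "continuous_on S \<tau>" for S
    using \<tau> by (intro DERIV_continuous_on) (auto intro: has_field_derivative_at_within)
  have "\<exists>x. \<tau> x = t" for t
  proof -
    define R where "R = \<bar>t - \<tau> 0\<bar> / c"
    have "0 \<le> R" "c * R = \<bar>t - \<tau> 0\<bar>" using c by (auto simp: R_def)
    then have "\<tau> (- R) \<le> t" "t \<le> \<tau> R" "- R \<le> R"
      using expand[of 0 R] expand[of "- R" 0] by auto
    then show ?thesis using IVT'[of \<tau> "- R" t R] cont by blast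
  qed
  then obtain p where p: "\<And>t. \<tau> (p t) = t" by metis
  have lip: "\<bar>p s - p t\<bar> \<le> \<bar>s - t\<bar> / c" for s t
    using expand_abs[of "p s" "p t"] c by (simp add: p field_simps abs_minus_commute)
  have "isCont p t" for t
  proof -
    have "((\<lambda>s. \<bar>s - t\<bar> / c) \<longlongrightarrow> \<bar>t - t\<bar> / c) (at t)"
      using c by (intro tendsto_intros) auto
    then have "((\<lambda>s. \<bar>s - t\<bar> / c) \<longlongrightarrow> 0) (at t)" by simp
    then have "((\<lambda>s. p s - p t) \<longlongrightarrow> 0) (at t)"
      by (rule Lim_null_comparison[rotated]) (use lip in auto)
    then show ?thesis by (simp add: isCont_def LIM_zero_iff)
  qed
  then have "(p has_real_derivative inverse (\<tau>' (p t))) (at t)" for t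
    using c(1) c(2)[of "p t"]
    by (intro DERIV_inverse_function[where f = \<tau> and a = "t - 1" and b = "t + 1"] \<tau>) (auto simp: p)
  moreover have "p (\<tau> x) = x" for x
    using expand_abs[of x "p (\<tau> x)"] c by (simp add: p mult_le_0_iff)
  ultimately show ?thesis using that p by metis
qed

section \<open>The rotating solution\<close>

text \<open>
  Conservation of energy and the sign of the velocity reduce the second-order equation to a
  first-order one; conversely, differentiating the first-order equation restores the second-order one.
\<close>

lemma is_rotation_iff:
  fixes V :: "real \<Rightarrow> real"
  assumes V: "\<And>x. (V has_real_derivative V' x) (at x)" and E: "\<And>x. V x < E"
  shows "is_rotation V E p \<longleftrightarrow>
    p 0 = 0 \<and> (\<forall>t. (p has_real_derivative sqrt (2 * (E - V (p t)))) (at t))"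
proof (intro iffI conjI allI; (elim conjE)?)
  assume rot: "is_rotation V E p"
  then show "p 0 = 0" by (simp add: is_rotation_def)
  fix t
  have "(deriv p t)\<^sup>2 / 2 + V (p t) = E" "0 < deriv p t" using rot by (auto simp: is_rotation_def)
  then have "sqrt (2 * (E - V (p t))) = deriv p t"
    by (intro real_sqrt_unique) (auto simp: field_simps)
  then show "(p has_real_derivative sqrt (2 * (E - V (p t)))) (at t)"
    using rot by (simp add: is_rotation_def differentiable_on_def DERIV_deriv_iff_real_differentiable)
next
  assume p0: "p 0 = 0" and "\<forall>t. (p has_real_derivative sqrt (2 * (E - V (p t)))) (at t)"
  then have p: "\<And>t. (p has_real_derivative sqrt (2 * (E - V (p t)))) (at t)" by blast
  then have dp: "deriv p = (\<lambda>t. sqrt (2 * (E - V (p t))))" by (auto intro: DERIV_imp_deriv)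
  have ddp: "(deriv p has_real_derivative - deriv V (p t)) (at t)" for t
    using E[of "p t"] unfolding dp DERIV_imp_deriv[OF V]
    by (auto intro!: derivative_eq_intros p DERIV_chain2[OF V] simp: field_simps)
  have "(deriv p t)\<^sup>2 / 2 + V (p t) = E" "0 < deriv p t" for t
    using E[of "p t"] by (auto simp: dp field_simps)
  then show "is_rotation V E p"
    using p0 p ddp DERIV_imp_deriv[OF ddp] unfolding is_rotation_def differentiable_on_def
    by (auto simp: real_differentiable_def) blast+
qed

text \<open>
  The rotation is the inverse of the travel time \<open>\<tau>\<close>. Any other solution \<open>q\<close> satisfies
  \<open>\<tau> (q t) = t\<close>, because the derivative of the left-hand side is \<open>1\<close>. The period of the
  definition is the travel time from \<open>- pi\<close> to \<open>pi\<close>, which by periodicity of the speed is the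
  travel time from \<open>0\<close> to \<open>2 * pi\<close>.
\<close>

lemma rotation_over_period:
  fixes V :: "real \<Rightarrow> real"
  assumes V: "\<And>x. (V has_real_derivative V' x) (at x)"
    and per: "\<And>x. V (x + 2 * pi) = V x"
    and B: "\<And>x. \<bar>V x\<bar> \<le> B" and \<delta>: "0 < \<delta>" "\<And>x. V x \<le> E - \<delta>"
  shows "(rotation V E has_real_derivative sqrt (2 * (E - V (rotation V E t)))) (at t)"
    and "rotation V E 0 = 0"
    and "rotation V E (rotation_period V E) = 2 * pi"
    and "0 < rotation_period V E"
    and "rotation_period V E \<le> 2 * pi / sqrt (2 * \<delta>)"
proof -
  define v where "v x = sqrt (2 * (E - V x))" for x
  have EV: "\<delta> \<le> E - V x" for x using \<delta>(2)[of x] by linarith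
  have v: "0 < v x" "sqrt (2 * \<delta>) \<le> v x" "v x \<le> sqrt (2 * (E + B))" for x
    using EV[of x] \<delta> B[of x] by (auto simp: v_def abs_le_iff)
  have vcont: "continuous_on S v" for S
    unfolding v_def using V
    by (intro continuous_intros DERIV_continuous_on) (auto intro: has_field_derivative_at_within)
  have "continuous_on UNIV (\<lambda>x. 1 / v x)"
    using v(1) by (intro continuous_intros vcont) (auto simp: less_imp_neq[symmetric])
  then obtain \<tau> where \<tau>0: "\<tau> 0 = 0" and \<tau>: "\<And>x. (\<tau> has_real_derivative 1 / v x) (at x)"
    using antiderivative_exists by blast
  \<comment> \<open>The bound \<open>B\<close> on \<open>V\<close> limits the speed, so the travel time is unbounded
      in both directions and its inverse is defined at all times.\<close>
  define c where "c = 1 / sqrt (2 * (E + B))"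
  have "0 < sqrt (2 * (E + B))" using v(1,3)[of 0] by linarith
  then have c: "0 < c" "\<And>x. c \<le> 1 / v x" unfolding c_def using v by (auto intro!: frac_le)
  obtain p where p: "\<And>t. \<tau> (p t) = t" "\<And>x. p (\<tau> x) = x"
    "\<And>t. (p has_real_derivative inverse (1 / v (p t))) (at t)"
    using global_inverse_function[OF \<tau> c] by blast
  have E: "V x < E" for x using EV[of x] \<delta> by linarith
  have "is_rotation V E p"
    unfolding is_rotation_iff[OF V E] using p(3) p(2)[of 0] by (simp add: \<tau>0 v_def)
  moreover have "q = p" if "is_rotation V E q" for q
  proof
    fix t
    have q: "q 0 = 0" "\<And>t. (q has_real_derivative v (q t)) (at t)"
      using that unfolding is_rotation_iff[OF V E] v_def by auto
    have "((\<lambda>t. \<tau> (q t) - t) has_real_derivative 0) (at s)" for s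
      using v(1)[of "q s"] by (auto intro!: derivative_eq_intros DERIV_chain2[OF \<tau>] q)
    then have "\<tau> (q t) - t = \<tau> (q 0) - 0"
      by (intro DERIV_isconst_all) auto
    then show "q t = p t" using p(2)[of "q t"] by (simp add: q \<tau>0)
  qed
  ultimately have rot: "rotation V E = p" unfolding rotation_def by (intro the_equality)
  show "(rotation V E has_real_derivative sqrt (2 * (E - V (rotation V E t)))) (at t)"
    using p(3)[of t] by (simp add: rot v_def)
  show "rotation V E 0 = 0" using p(2)[of 0] by (simp add: rot \<tau>0)
  have "((\<lambda>x. 1 / v x) has_integral \<tau> pi - \<tau> (- pi)) {- pi..pi}"
    by (intro fundamental_theorem_of_calculus)
      (auto intro: has_field_derivative_at_within \<tau> simp: has_real_derivative_iff_has_vector_derivative[symmetric])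
  moreover have "1 / v x = 1 / sqrt 2 * (1 / sqrt (E - V x))" for x
    unfolding v_def real_sqrt_mult by simp
  ultimately have "rotation_period V E = \<tau> pi - \<tau> (- pi)"
    unfolding rotation_period_def by (simp only: integral_unique flip: integral_mult_right)
  moreover have "\<tau> (- pi + 2 * pi) - \<tau> (- pi) = \<tau> (0 + 2 * pi) - \<tau> 0"
  proof (rule DERIV_isconst_all[where f = "\<lambda>x. \<tau> (x + 2 * pi) - \<tau> x"], rule allI)
    fix x
    have "((\<lambda>x. \<tau> (x + 2 * pi)) has_real_derivative 1 / v x) (at x)"
      using \<tau>[of "x + 2 * pi"] by (simp add: DERIV_shift v_def per)
    from DERIV_diff[OF this \<tau>[of x]]
    show "((\<lambda>x. \<tau> (x + 2 * pi) - \<tau> x) has_real_derivative 0) (at x)" by simp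
  qed
  ultimately have T: "rotation_period V E = \<tau> (2 * pi)" by (simp add: \<tau>0)
  show "rotation V E (rotation_period V E) = 2 * pi" by (simp add: T rot p)
  have "\<tau> 0 < \<tau> (2 * pi)"
  proof (rule DERIV_pos_imp_increasing[of 0 "2 * pi" \<tau>])
    show "\<exists>y. (\<tau> has_real_derivative y) (at x) \<and> 0 < y" for x
      using \<tau>[of x] v(1)[of x] by (intro exI[of _ "1 / v x"]) simp
  qed simp
  then show "0 < rotation_period V E" by (simp add: T \<tau>0)
  have "\<bar>\<tau> (2 * pi) - \<tau> 0\<bar> \<le> 1 / sqrt (2 * \<delta>) * (2 * pi)"
  proof (rule increment_bound[OF \<tau>])
    show "\<bar>1 / v s\<bar> \<le> 1 / sqrt (2 * \<delta>)" for s
      using v(1,2)[of s] \<delta>(1) by (auto intro!: frac_le)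
  qed auto
  then show "rotation_period V E \<le> 2 * pi / sqrt (2 * \<delta>)" by (simp add: T \<tau>0)
qed

text \<open>
  Integration by parts against the speed \<open>v\<close>: subtracting \<open>V'(p) / v\<close> from \<open>A\<close>, which takes the same
  value at both ends, leaves a function with derivative \<open>- (V'(p))\<^sup>2 / v\<^sup>2\<close>. The bounded
  integrand \<open>V''(p)\<close> is thus traded for one that decays like the reciprocal of the energy.
\<close>

lemma curvature_average_along_rotation:
  fixes V :: "real \<Rightarrow> real"
  assumes V: "\<And>x. (V has_real_derivative V' x) (at x)"
    and V': "\<And>x. (V' has_real_derivative V'' x) (at x)"
    and p: "\<And>t. (p has_real_derivative sqrt (2 * (E - V (p t)))) (at t)"
    and \<delta>: "0 < \<delta>" "\<And>x. V x \<le> E - \<delta>" and L: "\<And>x. \<bar>V' x\<bar> \<le> L"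
    and A: "\<And>t. (A has_real_derivative V'' (p t)) (at t)"
    and T: "0 \<le> T" and ends: "V (p T) = V (p 0)" "V' (p T) = V' (p 0)"
  shows "\<bar>A T - A 0\<bar> \<le> L\<^sup>2 / (2 * \<delta>) * T"
proof -
  define v where "v t = sqrt (2 * (E - V (p t)))" for t
  have EV: "2 * \<delta> \<le> 2 * (E - V x)" for x using \<delta>(2)[of x] by (simp add: algebra_simps)
  have v2: "(v t)\<^sup>2 = 2 * (E - V (p t))" and v_pos: "0 < v t" for t
    using EV[of "p t"] \<delta>(1) by (auto simp: v_def)
  have p': "(p has_real_derivative v t) (at t)" for t using p by (simp add: v_def)
  have v': "(v has_real_derivative - V' (p t)) (at t)" for t
    using EV[of "p t"] \<delta>(1) unfolding v_def
    by (auto intro!: derivative_eq_intros p DERIV_chain2[OF V] simp: field_simps)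
  define D where "D t = A t - V' (p t) / v t" for t
  have D: "(D has_real_derivative - ((V' (p t))\<^sup>2 / (v t)\<^sup>2)) (at t)" for t
  proof -
    have "((\<lambda>t. V' (p t) / v t) has_real_derivative
        (V'' (p t) * v t * v t - V' (p t) * (- V' (p t))) / (v t * v t)) (at t)"
      using v_pos[of t] by (intro DERIV_divide DERIV_chain2[OF V'] p' v') auto
    from DERIV_diff[OF A this] show ?thesis
      using v_pos[of t] unfolding D_def
      by (rule_tac DERIV_cong) (auto simp: power2_eq_square field_simps)
  qed
  have "\<bar>D T - D 0\<bar> \<le> L\<^sup>2 / (2 * \<delta>) * T"
  proof (rule increment_bound[OF D _ T])
    fix t
    have "(V' (p t))\<^sup>2 \<le> L\<^sup>2" using L[of "p t"] by (simp add: abs_le_square_iff[symmetric])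
    then show "\<bar>- ((V' (p t))\<^sup>2 / (v t)\<^sup>2)\<bar> \<le> L\<^sup>2 / (2 * \<delta>)"
      unfolding v2 abs_minus_cancel abs_divide using EV[of "p t"] \<delta>(1) by (intro frac_le) auto
  qed
  then show ?thesis by (simp add: D_def v_def ends)
qed

section \<open>Stability at high energy\<close>

theorem theorem3:
  fixes V :: "real \<Rightarrow> real" and \<kappa> :: real
  assumes C2: "C2 V"
    and periodic: "\<And>x. V (x + 2 * pi) = V x"
    and \<kappa>: "\<kappa> > 0"
  shows "\<exists>E\<^sub>\<kappa>. (\<forall>x. V x \<le> E\<^sub>\<kappa>) \<and>
           (\<forall>E>E\<^sub>\<kappa>. stable_matrix (linearized_floquet V \<kappa> E))"
proof -
  let ?V' = "deriv V" and ?V'' = "deriv (deriv V)"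
  have V: "(V has_real_derivative ?V' x) (at x)" and V': "(?V' has_real_derivative ?V'' x) (at x)" for x
    using C2 by (auto simp: C2_def differentiable_on_def DERIV_deriv_iff_real_differentiable)
  have cont: "continuous_on UNIV V" "continuous_on UNIV ?V'" "continuous_on UNIV ?V''"
    using C2 by (auto simp: C2_def intro: differentiable_imp_continuous_on)
  have per: "?V' (x + 2 * pi) = ?V' x" "?V'' (x + 2 * pi) = ?V'' x" for x
    by (intro deriv_periodic periodic)+
  obtain B where B: "\<And>x. \<bar>V x\<bar> \<le> B"
    using continuous_periodic_bounded[OF cont(1) periodic] by blast
  obtain L where L: "\<And>x. \<bar>?V' x\<bar> \<le> L"
    using continuous_periodic_bounded[OF cont(2) per(1)] by blast
  obtain K where K: "\<And>x. \<bar>?V'' x\<bar> \<le> K"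
    using continuous_periodic_bounded[OF cont(3) per(2)] by blast
  define M where "M = 2 * \<kappa> + K"
  have M: "2 * \<kappa> \<le> M" using K[of 0] by (simp add: M_def)
  \<comment> \<open>With \<open>\<delta> = E - B\<close> one has \<open>T\<^sup>2 \<le> 32 / \<delta>\<close>, so the error of the trace estimate, at most
      \<open>4 * M\<^sup>2 * T ^ 4\<close>, and the contribution of the mean of \<open>V''(p)\<close>, at most
      \<open>L\<^sup>2 / (2 * \<delta>) * T\<^sup>2\<close>, add up to at most \<open>C / \<delta> * T\<^sup>2\<close>. The term \<open>C / \<kappa>\<close> in the
      threshold makes this smaller than \<open>\<kappa> * T\<^sup>2\<close>; the term \<open>64 * M\<close> ensures \<open>M * T\<^sup>2 \<le> 1 / 2\<close>.\<close>
  define C where "C = L\<^sup>2 / 2 + 128 * M\<^sup>2"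
  define E\<^sub>0 where "E\<^sub>0 = B + (C / \<kappa> + 64 * M)"
  have "0 \<le> C" by (simp add: C_def)
  have "V x \<le> E\<^sub>0" for x
  proof -
    have "0 \<le> C / \<kappa> + 64 * M" using \<open>0 \<le> C\<close> \<kappa> M by auto
    then show ?thesis using B[of x] by (auto simp: E\<^sub>0_def abs_le_iff)
  qed
  moreover have "stable_matrix (linearized_floquet V \<kappa> E)" if E: "E > E\<^sub>0" for E
  proof -
    define \<delta> where "\<delta> = E - B"
    have \<delta>_large: "C / \<kappa> + 64 * M < \<delta>" using E by (simp add: \<delta>_def E\<^sub>0_def)
    moreover have "0 \<le> C / \<kappa>" using \<open>0 \<le> C\<close> \<kappa> by simp
    ultimately have \<delta>: "64 * M < \<delta>" "0 < \<delta>" "C < \<kappa> * \<delta>"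
      using M \<kappa> by (auto simp: pos_divide_less_eq[symmetric] mult.commute)
    have V_le: "V x \<le> E - \<delta>" for x using B[of x] by (simp add: \<delta>_def)
    define p where "p = rotation V E"
    define T where "T = rotation_period V E"
    define a where "a t = 2 * \<kappa> + ?V'' (p t)" for t
    note rot = rotation_over_period[OF V periodic B \<delta>(2) V_le, folded p_def T_def]
    have "continuous_on UNIV p"
      using rot(1) by (intro DERIV_continuous_on) (auto intro: has_field_derivative_at_within)
    then have acc: "continuous_on UNIV (\<lambda>t. ?V'' (p t))"
      by (rule continuous_on_compose2[OF cont(3)]) auto
    then obtain A where A: "\<And>t. (A has_real_derivative ?V'' (p t)) (at t)"
      using antiderivative_exists by blast
    have "\<bar>A T - A 0\<bar> \<le> L\<^sup>2 / (2 * \<delta>) * T"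
      using rot periodic[of 0] per(1)[of 0]
      by (intro curvature_average_along_rotation[OF V V' rot(1) \<delta>(2) V_le L A]) auto
    then have avg: "\<bar>T * (A T - A 0)\<bar> \<le> L\<^sup>2 / (2 * \<delta>) * T\<^sup>2"
      using mult_left_mono[of "\<bar>A T - A 0\<bar>" "L\<^sup>2 / (2 * \<delta>) * T" T] rot(4)
      by (simp add: abs_mult power2_eq_square mult_ac)
    have "T\<^sup>2 \<le> (2 * pi / sqrt (2 * \<delta>))\<^sup>2"
      using rot(4,5) by (intro power_mono) auto
    also have "\<dots> = 2 * pi\<^sup>2 / \<delta>"
      using \<delta>(2) by (simp add: power_divide power_mult_distrib)
    also have "\<dots> \<le> 2 * 4\<^sup>2 / \<delta>"
      using \<delta>(2) pi_less_4 by (intro divide_right_mono mult_left_mono power_mono) auto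
    finally have T2: "T\<^sup>2 \<le> 32 / \<delta>" by simp
    have "M * T\<^sup>2 \<le> M * (32 / \<delta>)" using T2 M \<kappa> by (intro mult_left_mono) auto
    also have "\<dots> \<le> 1 / 2" using \<delta> by (simp add: field_simps)
    finally have MT: "M * T\<^sup>2 \<le> 1 / 2" .
    have "\<bar>trace (floquet_matrix a T) - (2 - T * ((2 * \<kappa> * T + A T) - (2 * \<kappa> * 0 + A 0)))\<bar> \<le> 4 * M\<^sup>2 * T ^ 4"
    proof (rule floquet_trace_estimate[where A = "\<lambda>t. 2 * \<kappa> * t + A t"])
      show "continuous_on UNIV a" unfolding a_def by (intro continuous_intros acc)
      show "\<bar>a t\<bar> \<le> M" for t using K[of "p t"] \<kappa> by (auto simp: a_def M_def abs_le_iff)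
      show "((\<lambda>t. 2 * \<kappa> * t + A t) has_real_derivative a t) (at t)" for t
        by (auto intro!: derivative_eq_intros A simp: a_def)
    qed (use rot(4) MT in auto)
    moreover have "4 * M\<^sup>2 * T ^ 4 \<le> 128 * M\<^sup>2 / \<delta> * T\<^sup>2"
    proof -
      have "4 * M\<^sup>2 * T ^ 4 = (4 * M\<^sup>2 * T\<^sup>2) * T\<^sup>2" by (simp add: power_numeral_reduce)
      also have "\<dots> \<le> (4 * M\<^sup>2 * T\<^sup>2) * (32 / \<delta>)" by (intro mult_left_mono T2) simp
      finally show ?thesis by simp
    qed
    moreover have "L\<^sup>2 / (2 * \<delta>) * T\<^sup>2 + 128 * M\<^sup>2 / \<delta> * T\<^sup>2 = C / \<delta> * T\<^sup>2"
      by (simp add: C_def add_divide_distrib algebra_simps)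
    moreover have "C / \<delta> * T\<^sup>2 < \<kappa> * T\<^sup>2"
      using \<delta> rot(4) by (intro mult_strict_right_mono) (auto simp: divide_less_eq)
    moreover have "T * ((2 * \<kappa> * T + A T) - (2 * \<kappa> * 0 + A 0)) = 2 * (\<kappa> * T\<^sup>2) + T * (A T - A 0)"
      by (simp add: power2_eq_square algebra_simps)
    ultimately have "\<bar>trace (floquet_matrix a T) - (2 - 2 * (\<kappa> * T\<^sup>2))\<bar> < \<kappa> * T\<^sup>2"
      using avg by linarith
    moreover have "\<kappa> * T\<^sup>2 \<le> 1 / 2"
      using mult_right_mono[OF M, of "T\<^sup>2"] MT \<kappa> zero_le_power2[of T] by argo
    moreover have "linearized_floquet V \<kappa> E = floquet_matrix a T"
      by (simp add: linearized_floquet_def a_def[abs_def] p_def T_def)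
    ultimately show ?thesis by (simp add: stable_matrix_def abs_less_iff)
  qed
  ultimately show ?thesis by blast
qed

end
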